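(* Let $F$ be a two-dimensional lattice. Suppose there exist $w\in S_F^+$ and $\delta>0$ such that $F$ star-denies the positive Daugavet property with $S(B_{F^*},w,\delta)\cap S_{F^*}^+$. Then $X_1\oplus_F X_2$ is not a Daugavet range for any Banach spaces $X_1$ and $X_2$.
   Context: All Banach spaces are real and different from $\{0\}$. A nonzero continuous linear operator $G:X\to Y$ between Banach spaces is a Daugavet center if every (bounded) rank-1 operator $T:X\to Y$ satisfies $\|G+T\|=\|G\|+\|T\|$. A Banach space $X$ is a Daugavet range if there exist a Banach space $E$ and a Daugavet center $G:E\to X$. A two-dimensional lattice is a space $F=(\mathbb{R}^2,\|\cdot\|)$, where the norm satisfies $\|(1,0)\|=\|(0,1)\|=1$ and $\|(a_1,a_2)\|=\|(|a_1|,|a_2|)\|$ for all $(a_1,a_2)$, ordered coordinatewise. Its dual $F^*$ is $\mathbb{R}^2$ with $\|(f_1,f_2)\|_{F^*}=\max_{(a_1,a_2)\in B_F}|f_1a_1+f_2a_2|$ and is again a two-dimensional lattice. $B_F,B_{F^*}$ are the closed unit balls, $S_F^+=\{a\in F:\|a\|=1,\ a\ge 0\}$, and similarly $S_{F^*}^+$. For $w\in F$ with $\|w\|=1$ and $\varepsilon>0$: $S(B_{F^*},w,\varepsilon)=\{f^*\in B_{F^*}: f^*(w)>1-\varepsilon\}$. For Banach spaces $X_1,X_2$, $X_1\oplus_F X_2$ is the space of pairs $(x_1,x_2)$, $x_i\in X_i$, with norm $\|(x_1,x_2)\|=\|(\|x_1\|,\|x_2\|)\|_F$. $F$ star-denies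 the positive Daugavet property with $A\subset S_{F^*}^+$ if there is an $\varepsilon>0$ such that for every $f^*\in A$ there exists an $a\in S_F^+$ satisfying $\|\mathrm{Id}+f^*\otimes a\|<2-\varepsilon$, where $f^*\otimes a$ is the operator $b\mapsto f^*(b)a$ on $F$. *)

theory Defs
  imports "HOL-Analysis.Analysis"
begin

text \<open>
  The norm of an \<open>F\<close>-sum depends on the norm \<open>F\<close>, a term, so it cannot be the class norm of the
  product type. Norms are therefore passed explicitly, as functions on a real vector space.
\<close>

locale real_norm =
  fixes N :: "'a::real_vector \<Rightarrow> real"
  assumes norm_eq_0_iff: "N x = 0 \<longleftrightarrow> x = 0"
    and norm_triangle: "N (x + y) \<le> N x + N y"
    and norm_scale: "N (c *\<^sub>R x) = \<bar>c\<bar> * N x"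

definition bounded_linear_wrt ::
    "('a::real_vector \<Rightarrow> real) \<Rightarrow> ('b::real_vector \<Rightarrow> real) \<Rightarrow> ('a \<Rightarrow> 'b) \<Rightarrow> bool" where
  "bounded_linear_wrt N M T \<longleftrightarrow> linear T \<and> (\<exists>K. \<forall>x. M (T x) \<le> N x * K)"

text \<open>As in the library's \<^const>\<open>onorm\<close>, the quotient is \<open>0\<close> at \<open>x = 0\<close>.\<close>

definition onorm_wrt ::
    "('a::real_vector \<Rightarrow> real) \<Rightarrow> ('b::real_vector \<Rightarrow> real) \<Rightarrow> ('a \<Rightarrow> 'b) \<Rightarrow> real" where
  "onorm_wrt N M T = (SUP x. M (T x) / N x)"

definition daugavet_center ::
    "('a::real_vector \<Rightarrow> real) \<Rightarrow> ('b::real_vector \<Rightarrow> real) \<Rightarrow> ('a \<Rightarrow> 'b) \<Rightarrow> bool" where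
  "daugavet_center N M G \<longleftrightarrow>
     bounded_linear_wrt N M G \<and> (\<exists>x. G x \<noteq> 0) \<and>
     (\<forall>T. bounded_linear_wrt N M T \<and> dim (range T) = 1 \<longrightarrow>
          onorm_wrt N M (\<lambda>x. G x + T x) = onorm_wrt N M G + onorm_wrt N M T)"

text \<open>
  HOL cannot quantify over types inside a formula, so the domain \<open>E\<close> of the Daugavet center is a
  parameter: a space is a Daugavet range iff \<open>daugavet_range TYPE('e) M\<close> holds for some type \<open>'e\<close>,
  and it is not one iff this fails with \<open>'e\<close> arbitrary. That \<open>E\<close> is not \<open>{0}\<close> follows from \<open>G\<close>
  being nonzero.
\<close>

definition daugavet_range :: "'e::banach itself \<Rightarrow> ('b::real_vector \<Rightarrow> real) \<Rightarrow> bool" where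
  "daugavet_range E M \<longleftrightarrow> (\<exists>G :: 'e \<Rightarrow> 'b. daugavet_center norm M G)"

locale two_dim_lattice = real_norm F for F :: "real \<times> real \<Rightarrow> real" +
  assumes norm_e1: "F (1, 0) = 1"
    and norm_e2: "F (0, 1) = 1"
    and norm_abs: "F (a\<^sub>1, a\<^sub>2) = F (\<bar>a\<^sub>1\<bar>, \<bar>a\<^sub>2\<bar>)"

text \<open>
  A functional \<open>(f\<^sub>1, f\<^sub>2)\<close> acts by \<open>f\<^sub>1 * a\<^sub>1 + f\<^sub>2 * a\<^sub>2\<close>, which is the inner product of
  \<^typ>\<open>real \<times> real\<close>. By compactness of the unit ball the supremum is a maximum.
\<close>

definition dual_norm :: "(real \<times> real \<Rightarrow> real) \<Rightarrow> real \<times> real \<Rightarrow> real" where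
  "dual_norm F f = (SUP a \<in> {a. F a \<le> 1}. \<bar>f \<bullet> a\<bar>)"

definition pos_sphere :: "(real \<times> real \<Rightarrow> real) \<Rightarrow> (real \<times> real) set" where
  "pos_sphere F = {a. F a = 1 \<and> 0 \<le> fst a \<and> 0 \<le> snd a}"

definition dual_slice ::
    "(real \<times> real \<Rightarrow> real) \<Rightarrow> real \<times> real \<Rightarrow> real \<Rightarrow> (real \<times> real) set" where
  "dual_slice F w \<epsilon> = {f. dual_norm F f \<le> 1 \<and> f \<bullet> w > 1 - \<epsilon>}"

definition star_denies_pos_daugavet ::
    "(real \<times> real \<Rightarrow> real) \<Rightarrow> (real \<times> real) set \<Rightarrow> bool" where
  "star_denies_pos_daugavet F A \<longleftrightarrow>
     A \<subseteq> pos_sphere (dual_norm F) \<and>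
     (\<exists>\<epsilon>>0. \<forall>f\<in>A. \<exists>a\<in>pos_sphere F. onorm_wrt F F (\<lambda>b. b + (f \<bullet> b) *\<^sub>R a) < 2 - \<epsilon>)"

definition F_sum_norm ::
    "(real \<times> real \<Rightarrow> real) \<Rightarrow> 'a::real_normed_vector \<times> 'b::real_normed_vector \<Rightarrow> real" where
  "F_sum_norm F = (\<lambda>(x\<^sub>1, x\<^sub>2). F (norm x\<^sub>1, norm x\<^sub>2))"

end

theory Submission imports Defs begin

text \<open>
  Let \<open>G\<close> be a Daugavet center into \<open>X\<^sub>1 \<oplus>\<^sub>F X\<^sub>2\<close>, normalised to \<open>\<parallel>G\<parallel> = 1\<close>, and fix unit vectors
  \<open>y\<^sub>i \<in> X\<^sub>i\<close>. Perturbing \<open>G\<close> by \<open>e\<^sup>* \<otimes> (w\<^sub>1 y\<^sub>1, w\<^sub>2 y\<^sub>2)\<close> with \<open>\<parallel>e\<^sup>*\<parallel> = 1\<close> gives a vector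
  \<open>v = G x + e\<^sup>*(x) (w\<^sub>1 y\<^sub>1, w\<^sub>2 y\<^sub>2)\<close> of norm almost 2 with \<open>\<parallel>x\<parallel> = 1\<close>. A norming functional of \<open>v\<close>
  can be taken of the form \<open>x\<^sup>* = (f\<^sub>1 x\<^sub>1\<^sup>*, f\<^sub>2 x\<^sub>2\<^sup>*)\<close> with \<open>\<parallel>x\<^sub>i\<^sup>*\<parallel> \<le> 1\<close> and \<open>f\<close> in the positive
  dual sphere; then \<open>f(w)\<close> and \<open>x\<^sup>*(G x)\<close> are both almost 1. Take \<open>a\<close> with
  \<open>\<parallel>Id + f \<otimes> a\<parallel> < 2 - \<epsilon>\<close>, and let \<open>T = (x\<^sup>* \<circ> G) \<otimes> (a\<^sub>1 y\<^sub>1, a\<^sub>2 y\<^sub>2)\<close>. Its norm is almost 1, but with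
  \<open>b = (\<parallel>G\<^sub>1 u\<parallel>, \<parallel>G\<^sub>2 u\<parallel>)\<close> monotonicity of \<open>F\<close> yields \<open>\<parallel>G u + T u\<parallel> \<le> F (b + f(b) a) \<le> (2 - \<epsilon>) \<parallel>u\<parallel>\<close>.
\<close>

section \<open>Hahn--Banach\<close>

text \<open>Homogeneity is required only as an inequality for positive factors, the form that passes
  directly to infima. Equality and the value at 0 follow.\<close>

definition sublinear :: "('a::real_vector \<Rightarrow> real) \<Rightarrow> bool" where
  "sublinear p \<longleftrightarrow> (\<forall>x y. p (x + y) \<le> p x + p y) \<and> (\<forall>c>0. \<forall>x. p (c *\<^sub>R x) \<le> c * p x)"

lemma sublinear_add: "sublinear p \<Longrightarrow> p (x + y) \<le> p x + p y"
  and sublinear_scale_le: "sublinear p \<Longrightarrow> c > 0 \<Longrightarrow> p (c *\<^sub>R x) \<le> c * p x"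
  by (auto simp: sublinear_def)

lemma sublinear_zero: "sublinear p \<Longrightarrow> p 0 = 0"
  using sublinear_add[of p 0 0] sublinear_scale_le[of p "1/2" 0] by simp

lemma sublinear_scale:
  assumes "sublinear p" "c \<ge> 0"
  shows "p (c *\<^sub>R x) = c * p x"
proof (cases "c = 0")
  case False
  with assms have c: "c > 0" by simp
  have "p x \<le> inverse c * p (c *\<^sub>R x)"
    using sublinear_scale_le[OF assms(1), of "inverse c" "c *\<^sub>R x"] c by simp
  then show ?thesis
    using sublinear_scale_le[OF assms(1) c, of x] c by (simp add: field_simps)
qed (simp add: sublinear_zero assms)

lemma sublinear_minus: "sublinear p \<Longrightarrow> - p (- x) \<le> p x"
  using sublinear_add[of p x "- x"] by (simp add: sublinear_zero)

text \<open>The largest sublinear minorant of \<open>p\<close> that does not exceed \<open>- p z\<close> at \<open>- z\<close>.\<close>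

definition tilt :: "('a::real_vector \<Rightarrow> real) \<Rightarrow> 'a \<Rightarrow> 'a \<Rightarrow> real" where
  "tilt p z x = (INF t\<in>{0..}. p (x + t *\<^sub>R z) - t * p z)"

text \<open>A real infimum says something only over a set bounded below. Here
  \<open>p (t z) <= p (x + t z) + p (- x)\<close> gives the bound \<open>- p (- x)\<close>,
  independent of \<open>t\<close>.\<close>

lemma tilt_le:
  assumes "sublinear p" "t \<ge> 0"
  shows "tilt p z x \<le> p (x + t *\<^sub>R z) - t * p z"
  unfolding tilt_def
proof (rule cINF_lower)
  show "bdd_below ((\<lambda>t. p (x + t *\<^sub>R z) - t * p z) ` {0..})"
  proof (rule bdd_belowI2)
    fix t :: real assume "t \<in> {0..}"
    then show "- p (- x) \<le> p (x + t *\<^sub>R z) - t * p z"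
      using sublinear_add[OF assms(1), of "x + t *\<^sub>R z" "- x"] sublinear_scale[OF assms(1), of t z]
      by simp
  qed
qed (use assms in simp)

lemma tilt_near:
  assumes "e > 0"
  obtains t where "t \<ge> 0" "p (x + t *\<^sub>R z) - t * p z < tilt p z x + e"
proof -
  have "\<exists>y\<in>(\<lambda>t. p (x + t *\<^sub>R z) - t * p z) ` {0..}. y < tilt p z x + e"
    unfolding tilt_def by (rule cInf_lessD) (use assms in \<open>auto simp: ex_in_conv\<close>)
  then show ?thesis using that by auto
qed

text \<open>Nearly optimal parameters \<open>s\<close> for \<open>x\<close> and \<open>t\<close> for
  \<open>y\<close> make \<open>s + t\<close> admissible for \<open>x + y\<close>, and
  \<open>c * t\<close> is admissible for the multiple by \<open>c\<close> of a vector with parameter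
  \<open>t\<close>.\<close>

lemma sublinear_tilt:
  assumes "sublinear p"
  shows "sublinear (tilt p z)"
  unfolding sublinear_def
proof (intro conjI allI impI)
  fix x y
  show "tilt p z (x + y) \<le> tilt p z x + tilt p z y"
  proof (rule field_le_epsilon)
    fix e :: real assume e: "e > 0"
    obtain s where s: "s \<ge> 0" "p (x + s *\<^sub>R z) - s * p z < tilt p z x + e / 2"
      by (rule tilt_near[of "e / 2"]) (use e in auto)
    obtain t where t: "t \<ge> 0" "p (y + t *\<^sub>R z) - t * p z < tilt p z y + e / 2"
      by (rule tilt_near[of "e / 2"]) (use e in auto)
    have "tilt p z (x + y) \<le> p (x + y + (s + t) *\<^sub>R z) - (s + t) * p z"
      using s t by (intro tilt_le assms) auto
    also have "\<dots> = p ((x + s *\<^sub>R z) + (y + t *\<^sub>R z)) - s * p z - t * p z"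
      by (simp add: algebra_simps)
    also have "\<dots> \<le> p (x + s *\<^sub>R z) + p (y + t *\<^sub>R z) - s * p z - t * p z"
      using sublinear_add[OF assms] by simp
    finally show "tilt p z (x + y) \<le> tilt p z x + tilt p z y + e"
      using s t by simp
  qed
next
  fix c :: real and x assume c: "c > 0"
  show "tilt p z (c *\<^sub>R x) \<le> c * tilt p z x"
  proof (rule field_le_epsilon)
    fix e :: real assume e: "e > 0"
    obtain t where t: "t \<ge> 0" "p (x + t *\<^sub>R z) - t * p z < tilt p z x + e / c"
      by (rule tilt_near[of "e / c"]) (use e c in auto)
    have "tilt p z (c *\<^sub>R x) \<le> p (c *\<^sub>R x + (c * t) *\<^sub>R z) - (c * t) * p z"
      using t c by (intro tilt_le assms) auto
    also have "\<dots> = p (c *\<^sub>R (x + t *\<^sub>R z)) - c * t * p z"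
      by (simp add: algebra_simps)
    also have "\<dots> = c * (p (x + t *\<^sub>R z) - t * p z)"
      using sublinear_scale[OF assms, of c "x + t *\<^sub>R z"] c by (simp add: right_diff_distrib)
    also have "\<dots> \<le> c * (tilt p z x + e / c)"
      using t c by (intro mult_left_mono) auto
    finally show "tilt p z (c *\<^sub>R x) \<le> c * tilt p z x + e"
      using c by (simp add: algebra_simps)
  qed
qed

lemma tilt_le_self: "sublinear p \<Longrightarrow> tilt p z x \<le> p x"
  using tilt_le[of p 0 z x] by simp

lemma tilt_at_minus: "sublinear p \<Longrightarrow> tilt p z (- z) \<le> - p z"
  using tilt_le[of p 1 z "- z"] by (simp add: sublinear_zero)

text \<open>This supplies the bounds of chains for Zorn's lemma. Near-minimisers at \<open>x\<close>
  and at \<open>y\<close> may differ, but in a chain the smaller of the two serves both points. The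
  common majorant \<open>q\<close> bounds all values at \<open>x\<close> below by
  \<open>- q (- x)\<close>.\<close>

lemma sublinear_INF_chain:
  assumes "C \<noteq> {}" and sub: "\<And>p. p \<in> C \<Longrightarrow> sublinear p" and bound: "\<And>p. p \<in> C \<Longrightarrow> p \<le> q"
    and chain: "\<And>p r. p \<in> C \<Longrightarrow> r \<in> C \<Longrightarrow> p \<le> r \<or> r \<le> p"
  shows "sublinear (\<lambda>x. INF p\<in>C. p x)"
    and "\<And>p x. p \<in> C \<Longrightarrow> (INF p\<in>C. p x) \<le> p x"
proof -
  have bdd: "bdd_below ((\<lambda>p. p x) ` C)" for x
  proof (rule bdd_belowI2)
    fix p assume "p \<in> C"
    then show "- q (- x) \<le> p x"
      using sublinear_minus[OF sub, of p x] bound[of p] by (auto dest: le_funD[of _ _ "- x"])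
  qed
  show lower: "(INF p\<in>C. p x) \<le> p x" if "p \<in> C" for p x
    using bdd that by (rule cINF_lower)
  have near: "\<exists>p\<in>C. p x < (INF p\<in>C. p x) + e" if "e > 0" for x e
  proof -
    have "\<exists>y\<in>(\<lambda>p. p x) ` C. y < (INF p\<in>C. p x) + e"
      by (rule cInf_lessD) (use assms(1) that in auto)
    then show ?thesis by auto
  qed
  show "sublinear (\<lambda>x. INF p\<in>C. p x)"
    unfolding sublinear_def
  proof (intro conjI allI impI)
    fix x y
    show "(INF p\<in>C. p (x + y)) \<le> (INF p\<in>C. p x) + (INF p\<in>C. p y)"
    proof (rule field_le_epsilon)
      fix e :: real assume e: "e > 0"
      obtain p where p: "p \<in> C" "p x < (INF p\<in>C. p x) + e / 2"
        using near[of "e / 2"] e by auto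
      obtain r where r: "r \<in> C" "r y < (INF p\<in>C. p y) + e / 2"
        using near[of "e / 2"] e by auto
      obtain s where s: "s \<in> C" "s x \<le> p x" "s y \<le> r y"
        using chain[OF p(1) r(1)] p(1) r(1) by (auto simp: le_fun_def)
      have "(INF p\<in>C. p (x + y)) \<le> s (x + y)" by (rule lower[OF s(1)])
      also have "\<dots> \<le> s x + s y" by (rule sublinear_add[OF sub[OF s(1)]])
      finally show "(INF p\<in>C. p (x + y)) \<le> (INF p\<in>C. p x) + (INF p\<in>C. p y) + e"
        using s p r by simp
    qed
  next
    fix c :: real and x assume c: "c > 0"
    show "(INF p\<in>C. p (c *\<^sub>R x)) \<le> c * (INF p\<in>C. p x)"
    proof (rule field_le_epsilon)
      fix e :: real assume e: "e > 0"
      obtain p where p: "p \<in> C" "p x < (INF p\<in>C. p x) + e / c"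
        using near[of "e / c"] e c by auto
      have "(INF p\<in>C. p (c *\<^sub>R x)) \<le> p (c *\<^sub>R x)" by (rule lower[OF p(1)])
      also have "\<dots> \<le> c * p x" by (rule sublinear_scale_le[OF sub[OF p(1)] c])
      also have "\<dots> \<le> c * ((INF p\<in>C. p x) + e / c)"
        using p c by (intro mult_left_mono) auto
      finally show "(INF p\<in>C. p (c *\<^sub>R x)) \<le> c * (INF p\<in>C. p x) + e"
        using c by (simp add: algebra_simps)
    qed
  qed
qed

text \<open>A minimal sublinear functional equals all its tilts, so it is odd and hence linear.\<close>

theorem Hahn_Banach_sublinear:
  fixes q :: "'a::real_vector \<Rightarrow> real"
  assumes q: "sublinear q"
  obtains f where "linear f" "\<And>x. f x \<le> q x"
proof -
  define A where "A = {p. sublinear p \<and> p \<le> q}"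
  \<comment> \<open>The order is reversed, so that a maximal element is a minimal sublinear
    functional below \<open>q\<close>.\<close>
  have "\<exists>m\<in>A. \<forall>p\<in>A. p \<le> m \<longrightarrow> p = m"
  proof (rule predicate_Zorn)
    show "partial_order_on A (relation_of (\<lambda>p r. r \<le> p) A)"
      by (rule partial_order_on_relation_ofI) auto
  next
    fix C assume "C \<in> Chains (relation_of (\<lambda>p r. r \<le> p) A)"
    then have chain: "p \<le> r \<or> r \<le> p" and CA: "p \<in> A" if "p \<in> C" "r \<in> C" for p r
      using that by (auto simp: Chains_def relation_of_def)
    show "\<exists>u\<in>A. \<forall>p\<in>C. u \<le> p"
    proof (cases "C = {}")
      case True
      then show ?thesis using q by (auto simp: A_def)
    next
      case False
      have sub: "sublinear p" and le: "p \<le> q" if "p \<in> C" for p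
        using CA[OF that that] by (auto simp: A_def)
      let ?u = "\<lambda>x. INF p\<in>C. p x"
      note u = sublinear_INF_chain[OF False sub le chain]
      have low: "?u \<le> p" if "p \<in> C" for p
        using u(2)[OF _ _ _ _ that] by (auto simp: le_fun_def)
      moreover obtain p0 where "p0 \<in> C" using False by auto
      ultimately have "?u \<le> q" using le order_trans by blast
      then have "?u \<in> A" using u(1) by (auto simp: A_def)
      with low show ?thesis by blast
    qed
  qed
  then obtain m where m: "sublinear m" "m \<le> q"
    and min: "\<And>p. sublinear p \<Longrightarrow> p \<le> m \<Longrightarrow> p = m"
    unfolding A_def using order_trans by blast
  have "tilt m z = m" for z
    using min sublinear_tilt[OF m(1)] tilt_le_self[OF m(1)] by (simp add: le_fun_def)
  then have odd: "m (- z) = - m z" for z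
    using tilt_at_minus[OF m(1), of z] sublinear_minus[OF m(1), of z] by auto
  have "linear m"
  proof (rule linearI)
    fix x y
    \<comment> \<open>Oddness turns subadditivity at \<open>- x\<close> and \<open>- y\<close> into
      the reverse inequality.\<close>
    show "m (x + y) = m x + m y"
      using sublinear_add[OF m(1), of x y] sublinear_add[OF m(1), of "- x" "- y"]
        odd[of x] odd[of y] odd[of "x + y"] by simp
  next
    fix c x
    show "m (c *\<^sub>R x) = c *\<^sub>R m x"
    proof (cases "c \<ge> 0")
      case False
      then show ?thesis
        using sublinear_scale[OF m(1), of "- c" x] odd[of "c *\<^sub>R x"] by simp
    qed (simp add: sublinear_scale[OF m(1)])
  qed
  with m(2) that show ?thesis by (auto simp: le_fun_def)
qed

context real_norm
begin

lemma norm_zero: "N 0 = 0"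
  by (simp add: norm_eq_0_iff)

lemma norm_minus: "N (- x) = N x"
  using norm_scale[of "- 1" x] by simp

lemma norm_nonneg: "0 \<le> N x"
  using norm_triangle[of x "- x"] by (simp add: norm_zero norm_minus)

lemma norm_pos_iff: "0 < N x \<longleftrightarrow> x \<noteq> 0"
  using norm_nonneg[of x] norm_eq_0_iff[of x] by linarith

lemma sublinear_norm: "sublinear N"
  by (simp add: sublinear_def norm_triangle norm_scale)

text \<open>A linear functional below \<open>tilt N z\<close> is below \<open>N\<close> and is at
  most \<open>- N z\<close> at \<open>- z\<close>. The latter forces the value at \<open>z\<close>
  up to \<open>N z\<close>.\<close>

lemma norming_functional:
  obtains f where "linear f" "\<And>x. \<bar>f x\<bar> \<le> N x" "f z = N z"
proof -
  obtain f where f: "linear f" "\<And>x. f x \<le> tilt N z x"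
    using Hahn_Banach_sublinear[OF sublinear_tilt[OF sublinear_norm]] by blast
  have le: "f x \<le> N x" for x
    using f(2)[of x] tilt_le_self[OF sublinear_norm, of z x] by simp
  have "\<bar>f x\<bar> \<le> N x" for x
    using le[of x] le[of "- x"] linear_neg[OF f(1), of x] by (simp add: norm_minus)
  moreover have "f z = N z"
    using f(2)[of "- z"] tilt_at_minus[OF sublinear_norm, of z] linear_neg[OF f(1), of z] le[of z]
    by simp
  ultimately show ?thesis using f(1) that by blast
qed

end

lemma real_norm_norm: "real_norm (norm :: 'a::real_normed_vector \<Rightarrow> real)"
  by unfold_locales (auto simp: norm_triangle_ineq)

section \<open>Operator norms\<close>

context
  fixes N :: "'a::real_vector \<Rightarrow> real" and M :: "'b::real_vector \<Rightarrow> real"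
  assumes N: "real_norm N" and M: "real_norm M"
begin

lemma onorm_wrt_upper:
  assumes "bounded_linear_wrt N M T"
  shows "M (T x) \<le> onorm_wrt N M T * N x"
proof (cases "x = 0")
  case True
  with assms show ?thesis
    by (simp add: bounded_linear_wrt_def linear_0 real_norm.norm_zero[OF M] real_norm.norm_zero[OF N])
next
  case False
  then have pos: "N x > 0" by (simp add: real_norm.norm_pos_iff[OF N])
  obtain K where K: "M (T y) \<le> N y * K" for y
    using assms by (auto simp: bounded_linear_wrt_def)
  have "M (T y) / N y \<le> \<bar>K\<bar>" for y
  proof -
    have "M (T y) / N y \<le> (N y * \<bar>K\<bar>) / N y"
      using K[of y] real_norm.norm_nonneg[OF N, of y] mult_left_mono[of K "\<bar>K\<bar>" "N y"]
      by (intro divide_right_mono order_trans[OF K]) auto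
    then show ?thesis by (cases "N y = 0") auto
  qed
  then have "M (T x) / N x \<le> onorm_wrt N M T"
    unfolding onorm_wrt_def by (intro cSUP_upper bdd_aboveI2) auto
  with pos show ?thesis by (simp add: field_simps)
qed

lemma onorm_wrt_least:
  assumes "\<And>x. M (T x) \<le> K * N x" "0 \<le> K"
  shows "onorm_wrt N M T \<le> K"
  unfolding onorm_wrt_def
proof (rule cSUP_least)
  fix x
  show "M (T x) / N x \<le> K"
    using assms(1)[of x] assms(2) real_norm.norm_nonneg[OF N, of x]
    by (cases "N x = 0") (auto simp: field_simps)
qed simp

text \<open>Since \<open>c\<close> is nonnegative, a quotient above \<open>c\<close> cannot be the
  default value 0 taken at the origin, so the near-maximiser is nonzero.\<close>

lemma onorm_wrt_near:
  assumes "c < onorm_wrt N M T" "0 \<le> c"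
  obtains x where "x \<noteq> 0" "c * N x < M (T x)"
proof -
  have "\<exists>x. c < M (T x) / N x"
    using less_cSupD[OF _ assms(1)[unfolded onorm_wrt_def]] by auto
  then obtain x where x: "c < M (T x) / N x" by blast
  then have "N x \<noteq> 0" using assms(2) by auto
  then have pos: "N x > 0" using real_norm.norm_nonneg[OF N, of x] by simp
  show ?thesis
    using that[of x] x pos real_norm.norm_pos_iff[OF N, of x] by (simp add: field_simps)
qed

lemma bounded_linear_wrt_rank1:
  assumes "linear f" "\<And>x. \<bar>f x\<bar> \<le> K * N x"
  shows "bounded_linear_wrt N M (\<lambda>x. f x *\<^sub>R y)"
  unfolding bounded_linear_wrt_def
proof (intro conjI exI allI)
  show "linear (\<lambda>x. f x *\<^sub>R y)"
    using assms(1) by (intro linearI) (auto simp: linear_add linear_scale scaleR_add_left)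
  fix x
  show "M (f x *\<^sub>R y) \<le> N x * (K * M y)"
    using mult_right_mono[OF assms(2)[of x] real_norm.norm_nonneg[OF M, of y]]
    by (simp add: real_norm.norm_scale[OF M] algebra_simps)
qed

end

lemma dim_range_rank1:
  fixes f :: "'a::real_vector \<Rightarrow> real" and y :: "'b::real_vector"
  assumes "linear f" "f x \<noteq> 0" "y \<noteq> 0"
  shows "dim (range (\<lambda>x. f x *\<^sub>R y)) = 1"
proof -
  have "range f = UNIV"
  proof (intro equalityI subsetI)
    fix c :: real
    have "f ((c / f x) *\<^sub>R x) = c"
      using assms by (simp add: linear_scale)
    then show "c \<in> range f" by (metis rangeI)
  qed simp
  then have "range (\<lambda>x. f x *\<^sub>R y) = span {y}"
    by (simp add: span_singleton image_image[of "\<lambda>c. c *\<^sub>R y" f, symmetric])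
  then show ?thesis
    using assms(3) dim_eq_card_independent[of "{y}"] by simp
qed

section \<open>Two-dimensional lattices\<close>

context two_dim_lattice
begin

text \<open>Take absolute values of the coefficients of any norming functional. The bound by
  \<open>F\<close> survives, because sign changes can be moved to the argument, where
  \<open>F\<close> ignores them. The value at a nonnegative point does not decrease.\<close>

lemma positive_norming_functional:
  assumes "0 \<le> b1" "0 \<le> b2"
  obtains f1 f2 where "0 \<le> f1" "0 \<le> f2" "\<And>a1 a2. \<bar>f1 * a1 + f2 * a2\<bar> \<le> F (a1, a2)"
    "f1 * b1 + f2 * b2 = F (b1, b2)"
proof -
  obtain g where g: "linear g" "\<And>x. \<bar>g x\<bar> \<le> F x" "g (b1, b2) = F (b1, b2)"
    using norming_functional by blast
  define g1 g2 where "g1 = g (1, 0)" and "g2 = g (0, 1)"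
  have g_eq: "g (a1, a2) = g1 * a1 + g2 * a2" for a1 a2
  proof -
    have "g (a1, a2) = g (a1 *\<^sub>R (1, 0) + a2 *\<^sub>R (0, 1))" by simp
    also have "\<dots> = a1 *\<^sub>R g1 + a2 *\<^sub>R g2"
      unfolding g1_def g2_def linear_add[OF g(1)] linear_scale[OF g(1)] ..
    finally show ?thesis by (simp add: mult.commute)
  qed
  have bound: "\<bar>\<bar>g1\<bar> * a1 + \<bar>g2\<bar> * a2\<bar> \<le> F (a1, a2)" for a1 a2
  proof -
    define s1 where "s1 = (if 0 \<le> g1 * a1 then a1 else - a1)"
    define s2 where "s2 = (if 0 \<le> g2 * a2 then a2 else - a2)"
    have "\<bar>\<bar>g1\<bar> * a1 + \<bar>g2\<bar> * a2\<bar> \<le> \<bar>g1 * a1\<bar> + \<bar>g2 * a2\<bar>"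
      using abs_triangle_ineq[of "\<bar>g1\<bar> * a1" "\<bar>g2\<bar> * a2"] by (simp add: abs_mult)
    also have "\<dots> = g (s1, s2)" by (simp add: g_eq s1_def s2_def)
    also have "\<dots> \<le> F (s1, s2)" using g(2) abs_le_D1 by blast
    also have "F (s1, s2) = F (a1, a2)"
      using norm_abs[of s1 s2] norm_abs[of a1 a2] by (simp add: s1_def s2_def split: if_splits)
    finally show ?thesis .
  qed
  have "F (b1, b2) \<le> \<bar>g1\<bar> * b1 + \<bar>g2\<bar> * b2"
    unfolding g(3)[symmetric] g_eq using assms by (intro add_mono mult_right_mono) auto
  then have "\<bar>g1\<bar> * b1 + \<bar>g2\<bar> * b2 = F (b1, b2)"
    using bound[of b1 b2] by linarith
  with bound show ?thesis using that[of "\<bar>g1\<bar>" "\<bar>g2\<bar>"] by simp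
qed

text \<open>A functional norming the smaller point can be chosen with nonnegative coefficients,
  hence it is at least as large at the larger point.\<close>

lemma F_mono:
  assumes "0 \<le> a1" "a1 \<le> b1" "0 \<le> a2" "a2 \<le> b2"
  shows "F (a1, a2) \<le> F (b1, b2)"
proof -
  obtain f1 f2 where f: "0 \<le> f1" "0 \<le> f2" "\<And>a1 a2. \<bar>f1 * a1 + f2 * a2\<bar> \<le> F (a1, a2)"
    "f1 * a1 + f2 * a2 = F (a1, a2)"
    using positive_norming_functional assms by metis
  have "F (a1, a2) \<le> f1 * b1 + f2 * b2"
    using f assms by (metis add_mono mult_left_mono)
  also have "\<dots> \<le> F (b1, b2)" using f(3) abs_le_D1 by blast
  finally show ?thesis .
qed

lemma dual_norm_eq_1:
  assumes "\<And>a1 a2. \<bar>f1 * a1 + f2 * a2\<bar> \<le> F (a1, a2)"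
    and "f1 * b1 + f2 * b2 = F (b1, b2)" "(b1, b2) \<noteq> 0"
  shows "dual_norm F (f1, f2) = 1"
  unfolding dual_norm_def
proof (rule cSup_eq_maximum)
  let ?c = "inverse (F (b1, b2))"
  have pos: "F (b1, b2) > 0" using assms(3) by (simp add: norm_pos_iff)
  have "F (?c *\<^sub>R (b1, b2)) = 1"
    using pos unfolding norm_scale by simp
  moreover have "\<bar>(f1, f2) \<bullet> (?c *\<^sub>R (b1, b2))\<bar> = 1"
    using pos assms(2) unfolding inner_scaleR_right by (simp add: inner_Pair)
  ultimately show "1 \<in> (\<lambda>a. \<bar>(f1, f2) \<bullet> a\<bar>) ` {a. F a \<le> 1}"
    by (intro image_eqI[of _ _ "?c *\<^sub>R (b1, b2)"]) auto
next
  fix x assume "x \<in> (\<lambda>a. \<bar>(f1, f2) \<bullet> a\<bar>) ` {a. F a \<le> 1}"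
  then obtain a1 a2 where "F (a1, a2) \<le> 1" "x = \<bar>f1 * a1 + f2 * a2\<bar>" by auto
  then show "x \<le> 1" using assms(1)[of a1 a2] by simp
qed

lemma real_norm_F_sum:
  "real_norm (F_sum_norm F :: 'x::real_normed_vector \<times> 'y::real_normed_vector \<Rightarrow> real)"
proof
  fix x y :: "'x \<times> 'y" and c :: real
  obtain x1 x2 y1 y2 where [simp]: "x = (x1, x2)" "y = (y1, y2)" by fastforce
  show "F_sum_norm F x = 0 \<longleftrightarrow> x = 0"
    by (simp add: F_sum_norm_def norm_eq_0_iff zero_prod_def)
  show "F_sum_norm F (c *\<^sub>R x) = \<bar>c\<bar> * F_sum_norm F x"
    using norm_scale[of "\<bar>c\<bar>" "(norm x1, norm x2)"] by (simp add: F_sum_norm_def)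
  have "F (norm (x1 + y1), norm (x2 + y2)) \<le> F (norm x1 + norm y1, norm x2 + norm y2)"
    by (intro F_mono) (auto simp: norm_triangle_ineq)
  also have "\<dots> \<le> F (norm x1, norm x2) + F (norm y1, norm y2)"
    using norm_triangle[of "(norm x1, norm x2)" "(norm y1, norm y2)"] by simp
  finally show "F_sum_norm F (x + y) \<le> F_sum_norm F x + F_sum_norm F y"
    by (simp add: F_sum_norm_def)
qed

lemma F_sum_norm_le:
  assumes "norm x1 \<le> b1" "norm x2 \<le> b2"
  shows "F_sum_norm F (x1, x2) \<le> F (b1, b2)"
  using assms by (simp add: F_sum_norm_def F_mono)

text \<open>A positive functional norming the pair of norms is combined with norming functionals of
  \<open>v1\<close> and \<open>v2\<close>. The pieces are kept separate because the main proof needs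
  an estimate in terms of both coordinate norms, not only of the norm of the sum.\<close>

lemma F_sum_norming_functional:
  fixes v1 :: "'x::real_normed_vector" and v2 :: "'y::real_normed_vector"
  assumes "(v1, v2) \<noteq> 0"
  obtains f1 f2 h1 h2 where "(f1, f2) \<in> pos_sphere (dual_norm F)"
    "\<And>a1 a2. \<bar>f1 * a1 + f2 * a2\<bar> \<le> F (a1, a2)"
    "linear h1" "\<And>x. \<bar>h1 x\<bar> \<le> norm x" "linear h2" "\<And>x. \<bar>h2 x\<bar> \<le> norm x"
    "f1 * h1 v1 + f2 * h2 v2 = F_sum_norm F (v1, v2)"
proof -
  obtain f1 f2 where f: "0 \<le> f1" "0 \<le> f2" "\<And>a1 a2. \<bar>f1 * a1 + f2 * a2\<bar> \<le> F (a1, a2)"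
    "f1 * norm v1 + f2 * norm v2 = F (norm v1, norm v2)"
    using positive_norming_functional norm_ge_zero by metis
  have "(norm v1, norm v2) \<noteq> 0" using assms by (auto simp: zero_prod_def)
  then have "(f1, f2) \<in> pos_sphere (dual_norm F)"
    using dual_norm_eq_1[OF f(3,4)] f(1,2) by (simp add: pos_sphere_def)
  moreover obtain h1 where "linear h1" "\<And>x. \<bar>h1 x\<bar> \<le> norm x" "h1 v1 = norm v1"
    using real_norm.norming_functional[OF real_norm_norm] by blast
  moreover obtain h2 where "linear h2" "\<And>x. \<bar>h2 x\<bar> \<le> norm x" "h2 v2 = norm v2"
    using real_norm.norming_functional[OF real_norm_norm] by blast
  ultimately show ?thesis
    using that f(3,4) by (simp add: F_sum_norm_def)
qed

end

section \<open>Daugavet centers into an F-sum\<close>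

theorem lemma3p7:
  fixes F :: "real \<times> real \<Rightarrow> real"
  assumes "two_dim_lattice F"
    and "\<exists>w\<in>pos_sphere F. \<exists>\<delta>>0.
           star_denies_pos_daugavet F (dual_slice F w \<delta> \<inter> pos_sphere (dual_norm F))"
    and "(UNIV :: 'x::banach set) \<noteq> {0}"
    and "(UNIV :: 'y::banach set) \<noteq> {0}"
  shows "\<not> daugavet_range TYPE('e::banach) (F_sum_norm F :: 'x \<times> 'y \<Rightarrow> real)"
proof
  interpret two_dim_lattice F by fact
  let ?M = "F_sum_norm F :: 'x \<times> 'y \<Rightarrow> real"
  let ?N = "norm :: 'e \<Rightarrow> real"
  note N = real_norm_norm[where 'a = 'e]
  note M = real_norm_F_sum[where 'x = 'x and 'y = 'y]
  assume "daugavet_range TYPE('e) ?M"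
  then obtain G :: "'e \<Rightarrow> 'x \<times> 'y" and x0 where G: "bounded_linear_wrt ?N ?M G" "G x0 \<noteq> 0"
    and center: "\<And>T. bounded_linear_wrt ?N ?M T \<Longrightarrow> dim (range T) = 1 \<Longrightarrow>
          onorm_wrt ?N ?M (\<lambda>x. G x + T x) = onorm_wrt ?N ?M G + onorm_wrt ?N ?M T"
    unfolding daugavet_range_def daugavet_center_def by blast
  define g where "g = onorm_wrt ?N ?M G"
  have linG: "linear G" using G(1) by (simp add: bounded_linear_wrt_def)
  have G_le: "?M (G x) \<le> g * norm x" for x
    unfolding g_def by (rule onorm_wrt_upper[OF N M G(1)])
  have "0 < ?M (G x0)" using G(2) by (simp add: real_norm.norm_pos_iff[OF M])
  then have x0: "x0 \<noteq> 0" and "0 < g * norm x0"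
    using G(2) linear_0[OF linG] G_le[of x0] by auto
  then have g: "0 < g" by (simp add: zero_less_mult_iff)
  obtain w1 w2 \<delta> where w: "(w1, w2) \<in> pos_sphere F" and \<delta>: "\<delta> > 0" and
    denies: "star_denies_pos_daugavet F (dual_slice F (w1, w2) \<delta> \<inter> pos_sphere (dual_norm F))"
    using assms(2) by auto
  obtain \<epsilon> where \<epsilon>: "\<epsilon> > 0" and
    deny: "\<And>f. f \<in> dual_slice F (w1, w2) \<delta> \<Longrightarrow> f \<in> pos_sphere (dual_norm F) \<Longrightarrow>
      \<exists>a\<in>pos_sphere F. onorm_wrt F F (\<lambda>b. b + (f \<bullet> b) *\<^sub>R a) < 2 - \<epsilon>"
    using denies unfolding star_denies_pos_daugavet_def by blast
  obtain x1 :: 'x where "x1 \<noteq> 0" using assms(3) by auto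
  then obtain y1 :: 'x where y1: "norm y1 = 1" using norm_sgn[of x1] by auto
  obtain x2 :: 'y where "x2 \<noteq> 0" using assms(4) by auto
  then obtain y2 :: 'y where y2: "norm y2 = 1" using norm_sgn[of x2] by auto
  have sphere: "?M (a1 *\<^sub>R y1, a2 *\<^sub>R y2) = 1" "(a1 *\<^sub>R y1, a2 *\<^sub>R y2) \<noteq> 0"
    if "(a1, a2) \<in> pos_sphere F" for a1 a2
  proof -
    show *: "?M (a1 *\<^sub>R y1, a2 *\<^sub>R y2) = 1"
      using that y1 y2 by (simp add: F_sum_norm_def pos_sphere_def)
    show "(a1 *\<^sub>R y1, a2 *\<^sub>R y2) \<noteq> 0"
      using * real_norm.norm_zero[OF M] by (metis zero_neq_one)
  qed
  \<comment> \<open>\<open>\<eta> <= \<delta>\<close> will put the functional into the slice,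
    \<open>\<eta> <= \<epsilon>\<close> gives the final contradiction, and
    \<open>\<eta> <= 1\<close> keeps \<open>1 - \<eta>\<close> nonnegative.\<close>
  define \<eta> where "\<eta> = min (min \<delta> \<epsilon>) 1"
  have \<eta>: "0 < \<eta>" "\<eta> \<le> \<delta>" "\<eta> \<le> \<epsilon>" "\<eta> \<le> 1" using \<delta> \<epsilon> by (auto simp: \<eta>_def)

  obtain e where e: "linear e" "\<And>x. \<bar>e x\<bar> \<le> norm x" "e x0 = norm x0"
    using real_norm.norming_functional[OF N] by blast
  define y where "y = (w1 *\<^sub>R y1, w2 *\<^sub>R y2)"
  \<comment> \<open>\<open>G\<close> is not rescaled. Instead the factor \<open>g\<close> gives
    \<open>S\<close> norm at least \<open>g\<close>, so the norm of \<open>G + S\<close> is at least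
    \<open>2 * g\<close>.\<close>
  define S where "S = (\<lambda>x. (g * e x) *\<^sub>R y)"
  have lin_ge: "linear (\<lambda>x. g * e x)"
    using e(1) by (intro linearI) (auto simp: linear_add linear_scale algebra_simps)
  have ge: "\<bar>g * e x\<bar> \<le> g * norm x" for x
    using e(2)[of x] g by (simp add: abs_mult)
  have S: "bounded_linear_wrt ?N ?M S"
    unfolding S_def by (rule bounded_linear_wrt_rank1[OF N M lin_ge ge])
  have "dim (range S) = 1"
    unfolding S_def y_def using sphere(2)[OF w] g e(3) x0
    by (intro dim_range_rank1[OF lin_ge, of x0]) auto
  then have "onorm_wrt ?N ?M (\<lambda>x. G x + S x) = g + onorm_wrt ?N ?M S"
    using center[OF S] by (simp add: g_def)
  moreover have "g * norm x0 \<le> onorm_wrt ?N ?M S * norm x0"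
    using onorm_wrt_upper[OF N M S, of x0] sphere(1)[OF w] e(3) g
    unfolding S_def y_def real_norm.norm_scale[OF M] by simp
  then have "g \<le> onorm_wrt ?N ?M S" using x0 by simp
  moreover have "(2 - \<eta>) * g < 2 * g" "0 \<le> (2 - \<eta>) * g" using g \<eta> by auto
  ultimately have "(2 - \<eta>) * g < onorm_wrt ?N ?M (\<lambda>x. G x + S x)" by simp
  then obtain x where x: "x \<noteq> 0" "(2 - \<eta>) * g * norm x < ?M (G x + S x)"
    using \<open>0 \<le> (2 - \<eta>) * g\<close> by (rule onorm_wrt_near[OF N M])
  obtain v1 v2 where v: "G x + S x = (v1, v2)" by fastforce
  have "0 \<le> (2 - \<eta>) * g * norm x" using g \<eta> by simp
  then have "(v1, v2) \<noteq> 0"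
    using x(2) v real_norm.norm_pos_iff[OF M, of "(v1, v2)"] by simp
  then obtain f1 f2 h1 h2 where f: "(f1, f2) \<in> pos_sphere (dual_norm F)"
    "\<And>a1 a2. \<bar>f1 * a1 + f2 * a2\<bar> \<le> F (a1, a2)"
    and h: "linear h1" "\<And>x. \<bar>h1 x\<bar> \<le> norm x" "linear h2" "\<And>x. \<bar>h2 x\<bar> \<le> norm x"
    "f1 * h1 v1 + f2 * h2 v2 = ?M (v1, v2)"
    using F_sum_norming_functional by metis
  have f_nonneg: "0 \<le> f1" "0 \<le> f2" using f(1) by (auto simp: pos_sphere_def)
  define h where "h = (\<lambda>u. f1 * h1 (fst u) + f2 * h2 (snd u))"
  have linh: "linear h"
    using h(1,3) unfolding h_def
    by (intro linearI) (auto simp: linear_add linear_scale algebra_simps)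
  have h_le: "\<bar>h u\<bar> \<le> f1 * norm (fst u) + f2 * norm (snd u)" for u
  proof -
    have "\<bar>h u\<bar> \<le> f1 * \<bar>h1 (fst u)\<bar> + f2 * \<bar>h2 (snd u)\<bar>"
      unfolding h_def using f_nonneg
      by (metis abs_mult abs_of_nonneg abs_triangle_ineq)
    also have "\<dots> \<le> f1 * norm (fst u) + f2 * norm (snd u)"
      by (intro add_mono mult_left_mono h f_nonneg)
    finally show ?thesis .
  qed
  have h_le_M: "\<bar>h u\<bar> \<le> ?M u" for u
    using h_le[of u] f(2)[of "norm (fst u)" "norm (snd u)"]
    by (simp add: F_sum_norm_def case_prod_beta)
  have hG: "\<bar>h (G u)\<bar> \<le> g * norm u" for u
    using h_le_M[of "G u"] G_le[of u] by simp
  have "\<bar>h y\<bar> \<le> f1 * w1 + f2 * w2"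
    using h_le[of y] w y1 y2 by (simp add: y_def pos_sphere_def)
  have "h (G x + S x) = ?M (G x + S x)"
    using h(5) by (simp add: v h_def)
  then have "(2 - \<eta>) * g * norm x < h (G x) + g * e x * h y"
    using x(2) by (simp add: linear_add[OF linh] S_def linear_scale[OF linh])
  moreover have "g * e x * h y \<le> g * norm x * \<bar>h y\<bar>"
  proof -
    have "g * e x * h y \<le> \<bar>g * e x\<bar> * \<bar>h y\<bar>" by (metis abs_ge_self abs_mult)
    also have "\<dots> \<le> g * norm x * \<bar>h y\<bar>" by (intro mult_right_mono ge) simp
    finally show ?thesis .
  qed
  \<comment> \<open>Both terms on the right are at most \<open>g * norm x\<close>, so each must
    exceed \<open>(1 - \<eta>) * (g * norm x)\<close>. The first then shows that \<open>h\<close>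
    composed with \<open>G\<close> has norm almost \<open>g\<close>, the second that
    \<open>(f1, f2)\<close> lies in the slice.\<close>
  ultimately have sum: "(2 - \<eta>) * (g * norm x) < h (G x) + g * norm x * \<bar>h y\<bar>"
    by (simp add: algebra_simps)
  have gx: "0 < g * norm x" using g x(1) by simp
  have "\<bar>h y\<bar> \<le> 1" using h_le_M[of y] sphere(1)[OF w] by (simp add: y_def)
  then have "g * norm x * \<bar>h y\<bar> \<le> g * norm x" using gx by (intro mult_left_le) auto
  with sum have hGx: "(1 - \<eta>) * (g * norm x) < h (G x)" by (simp add: algebra_simps)
  have "(1 - \<eta>) * (g * norm x) < \<bar>h y\<bar> * (g * norm x)"
    using sum hG[of x] by (simp add: algebra_simps)
  then have "1 - \<eta> < \<bar>h y\<bar>" using gx by (simp only: mult_less_cancel_right_pos)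
  then have "(f1, f2) \<in> dual_slice F (w1, w2) \<delta>"
    using \<open>\<bar>h y\<bar> \<le> f1 * w1 + f2 * w2\<close> \<eta> f(1)
    by (simp add: dual_slice_def pos_sphere_def inner_Pair)
  from deny[OF this f(1)] obtain a1 a2 where a: "(a1, a2) \<in> pos_sphere F"
    and small: "onorm_wrt F F (\<lambda>b. b + ((f1, f2) \<bullet> b) *\<^sub>R (a1, a2)) < 2 - \<epsilon>"
    by auto

  \<comment> \<open>Boundedness turns the estimate of the operator norm into the pointwise one in
    \<open>F_small\<close>. The constant 2 is 1 for the identity plus 1 for the rank-1 part, as
    \<open>F (a1, a2) = 1\<close> and the functional is dominated by \<open>F\<close>.\<close>
  have bl: "bounded_linear_wrt F F (\<lambda>b. b + ((f1, f2) \<bullet> b) *\<^sub>R (a1, a2))"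
    unfolding bounded_linear_wrt_def
  proof (intro conjI exI allI)
    show "linear (\<lambda>b. b + ((f1, f2) \<bullet> b) *\<^sub>R (a1, a2))"
      by (intro linearI) (auto simp: inner_add_right algebra_simps)
    fix b :: "real \<times> real"
    have "F (b + ((f1, f2) \<bullet> b) *\<^sub>R (a1, a2)) \<le> F b + \<bar>(f1, f2) \<bullet> b\<bar> * F (a1, a2)"
      using norm_triangle norm_scale by metis
    moreover have "\<bar>(f1, f2) \<bullet> b\<bar> \<le> F b"
      using f(2)[of "fst b" "snd b"] by (simp add: inner_prod_def)
    ultimately show "F (b + ((f1, f2) \<bullet> b) *\<^sub>R (a1, a2)) \<le> F b * 2"
      using a by (simp add: pos_sphere_def)
  qed
  define k where "k = onorm_wrt F F (\<lambda>b. b + ((f1, f2) \<bullet> b) *\<^sub>R (a1, a2))"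
  have F_small: "F (b + ((f1, f2) \<bullet> b) *\<^sub>R (a1, a2)) \<le> k * F b" for b
    unfolding k_def by (rule onorm_wrt_upper[OF real_norm_axioms real_norm_axioms bl])
  have "0 \<le> k"
    using F_small[of "(1, 0)"] norm_nonneg by (smt (verit) mult_cancel_left1 norm_e1 mult.commute)

  define z where "z = (a1 *\<^sub>R y1, a2 *\<^sub>R y2)"
  define T where "T = (\<lambda>u. h (G u) *\<^sub>R z)"
  have linhG: "linear (\<lambda>u. h (G u))"
    using linear_compose[OF linG linh] by (simp add: o_def)
  have T: "bounded_linear_wrt ?N ?M T"
    unfolding T_def by (rule bounded_linear_wrt_rank1[OF N M linhG hG])
  have "0 < h (G x)"
    using hGx gx \<eta> by (smt (verit) mult_nonneg_nonneg)
  then have "dim (range T) = 1"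
    unfolding T_def z_def using sphere(2)[OF a]
    by (intro dim_range_rank1[OF linhG, of x]) auto
  then have "onorm_wrt ?N ?M (\<lambda>x. G x + T x) = g + onorm_wrt ?N ?M T"
    using center[OF T] by (simp add: g_def)
  \<comment> \<open>The vector \<open>x\<close> found for the first perturbation also tests
    \<open>T\<close>.\<close>
  moreover have "(1 - \<eta>) * g < onorm_wrt ?N ?M T"
  proof -
    have "(1 - \<eta>) * g * norm x < ?M (T x)"
      using hGx \<open>0 < h (G x)\<close> sphere(1)[OF a]
      unfolding T_def z_def real_norm.norm_scale[OF M] by (simp add: mult.assoc)
    also have "\<dots> \<le> onorm_wrt ?N ?M T * norm x" by (rule onorm_wrt_upper[OF N M T])
    finally show ?thesis using x(1) by simp
  qed
  moreover have "onorm_wrt ?N ?M (\<lambda>x. G x + T x) \<le> k * g"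
  proof (rule onorm_wrt_least[OF N M])
    fix u
    obtain u1 u2 where u: "G u = (u1, u2)" by fastforce
    let ?c = "f1 * norm u1 + f2 * norm u2"
    have c: "\<bar>h (G u)\<bar> \<le> ?c" using h_le[of "G u"] by (simp add: u)
    \<comment> \<open>As \<open>a1\<close> and \<open>a2\<close> are nonnegative, the right-hand
      sides are the coordinates of \<open>Id\<close> plus the rank-1 operator of
      \<open>(f1, f2)\<close> and \<open>(a1, a2)\<close>, applied to
      \<open>(norm u1, norm u2)\<close>.\<close>
    have "norm (u1 + (h (G u) * a1) *\<^sub>R y1) \<le> norm u1 + ?c * a1"
      "norm (u2 + (h (G u) * a2) *\<^sub>R y2) \<le> norm u2 + ?c * a2"
      using c a y1 y2 mult_right_mono[OF c, of a1] mult_right_mono[OF c, of a2]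
        norm_triangle_ineq[of u1 "(h (G u) * a1) *\<^sub>R y1"]
        norm_triangle_ineq[of u2 "(h (G u) * a2) *\<^sub>R y2"]
      by (auto simp: pos_sphere_def abs_mult)
    from F_sum_norm_le[OF this]
    have "?M (G u + T u) \<le> F (norm u1 + ?c * a1, norm u2 + ?c * a2)"
      by (simp add: T_def z_def u)
    also have "\<dots> \<le> k * F (norm u1, norm u2)"
      using F_small[of "(norm u1, norm u2)"] by (simp add: inner_Pair)
    also have "\<dots> \<le> k * (g * norm u)"
      using G_le[of u] \<open>0 \<le> k\<close> by (intro mult_left_mono) (auto simp: u F_sum_norm_def)
    finally show "?M (G u + T u) \<le> k * g * norm u" by (simp add: mult.assoc)
  qed (use g \<open>0 \<le> k\<close> in simp)
  \<comment> \<open>The center property makes \<open>G + T\<close> larger than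
    \<open>g + (1 - \<eta>) * g\<close>, yet its norm is at most \<open>k * g\<close> with
    \<open>k < 2 - \<epsilon> <= 2 - \<eta>\<close>.\<close>
  ultimately have "(2 - \<eta>) * g < k * g" by (simp add: algebra_simps)
  then have "2 - \<eta> < k" using g by simp
  then show False using small \<eta> by (simp add: k_def)
qed

end
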